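(* Let $(G,\Delta,\varepsilon)$ be a comonad on a category $\mathcal{A}$, let $L:\mathcal{B}\to\mathcal{A}$ be a functor with right adjoint $R:\mathcal{A}\to\mathcal{B}$ and unit $\eta:id_{\mathcal{B}}\to RL$, and let $\varphi:LR\to G$ be a morphism of comonads. Let $K_\varphi:\mathcal{B}\to\mathcal{A}_G$ be the functor given by $K_\varphi Y=(LY,\varphi_{LY}\circ L\eta_Y)$ on objects and $K_\varphi f=Lf$ on morphisms, and let $\alpha=R\varphi\circ\eta R:R\to RG$. Suppose that for every $G$-coalgebra $(X,x)$ the equalizer in $\mathcal{B}$ of the pair of morphisms $\alpha_X,Rx:RX\to RGX$ exists. Then $K_\varphi$ has a right adjoint $D_\varphi:\mathcal{A}_G\to\mathcal{B}$, whose value at $(X,x)$ is the equalizer $$D_\varphi X\xrightarrow{\;eq_X\;}RX\;\overset{\alpha_X}{\underset{Rx}{\rightrightarrows}}\;RGX.$$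
   Context: A comonad $(G,\Delta,\varepsilon)$ on $\mathcal{A}$ is a functor $G:\mathcal{A}\to\mathcal{A}$ with natural transformations $\Delta:G\to G^2$, $\varepsilon:G\to id_{\mathcal{A}}$ such that $G\Delta\circ\Delta=\Delta G\circ\Delta$ and $\varepsilon G\circ\Delta=id_G=G\varepsilon\circ\Delta$. The category $\mathcal{A}_G$ of $G$-coalgebras has as objects the pairs $(X,x)$ with $x:X\to GX$ in $\mathcal{A}$ such that $Gx\circ x=\Delta_X\circ x$ and $\varepsilon_X\circ x=id_X$; morphisms $(X,x)\to(X',x')$ are the $f:X\to X'$ in $\mathcal{A}$ with $Gf\circ x=x'\circ f$. With $\epsilon$ the counit of $L\dashv R$, $LR$ is regarded as the comonad $(LR,\delta,\epsilon)$ with $\delta=L\eta R$. A morphism of comonads $\varphi:LR\to G$ is a natural transformation with $\Delta\circ\varphi=\varphi^2\circ\delta$ and $\varepsilon\circ\varphi=\epsilon$, where $\varphi^2_X=\varphi_{GX}\circ LR\varphi_X$. Under these conditions $K_\varphi$ is a well-defined functor into $\mathcal{A}_G$ whose composite with the forgetful functor $\mathcal{A}_G\to\mathcal{A}$ is $L$. *)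

theory Defs
  imports Main
begin

section \<open>Categories, functors and natural transformations\<close>

record ('o, 'm) cat =
  Obj :: "'o set"
  Arr :: "'m set"
  Dom :: "'m \<Rightarrow> 'o"
  Cod :: "'m \<Rightarrow> 'o"
  Ide :: "'o \<Rightarrow> 'm"
  Comp :: "'m \<Rightarrow> 'm \<Rightarrow> 'm"  (infixr "\<odot>\<index>" 70)

text \<open>\<^term>\<open>Comp C g f\<close> is the composite of \<^term>\<open>f\<close> followed by \<^term>\<open>g\<close>; only its values on
  composable arrows are constrained.\<close>

definition hom :: "('o, 'm) cat \<Rightarrow> 'o \<Rightarrow> 'o \<Rightarrow> 'm set"
  where "hom C X Y = {f \<in> Arr C. Dom C f = X \<and> Cod C f = Y}"

locale category =
  fixes C :: "('o, 'm) cat" (structure)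
  assumes dom_obj: "f \<in> Arr C \<Longrightarrow> Dom C f \<in> Obj C"
    and cod_obj: "f \<in> Arr C \<Longrightarrow> Cod C f \<in> Obj C"
    and id_hom: "X \<in> Obj C \<Longrightarrow> Ide C X \<in> hom C X X"
    and comp_hom: "f \<in> hom C X Y \<Longrightarrow> g \<in> hom C Y Z \<Longrightarrow> g \<odot> f \<in> hom C X Z"
    and id_left: "f \<in> hom C X Y \<Longrightarrow> Ide C Y \<odot> f = f"
    and id_right: "f \<in> hom C X Y \<Longrightarrow> f \<odot> Ide C X = f"
    and comp_assoc: "f \<in> hom C W X \<Longrightarrow> g \<in> hom C X Y \<Longrightarrow> h \<in> hom C Y Z \<Longrightarrow>
      (h \<odot> g) \<odot> f = h \<odot> (g \<odot> f)"

record ('o, 'm, 'p, 'n) func =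
  obj_map :: "'o \<Rightarrow> 'p"  (infixr "\<cdot>" 90)
  arr_map :: "'m \<Rightarrow> 'n"  (infixr "\<star>" 90)

locale is_functor = A: category A + B: category B
  for A :: "('o, 'm) cat" and B :: "('p, 'n) cat" and F :: "('o, 'm, 'p, 'n) func" +
  assumes map_obj: "X \<in> Obj A \<Longrightarrow> F \<cdot> X \<in> Obj B"
    and map_hom: "f \<in> hom A X Y \<Longrightarrow> F \<star> f \<in> hom B (F \<cdot> X) (F \<cdot> Y)"
    and map_id: "X \<in> Obj A \<Longrightarrow> F \<star> Ide A X = Ide B (F \<cdot> X)"
    and map_comp: "f \<in> hom A X Y \<Longrightarrow> g \<in> hom A Y Z \<Longrightarrow>
      F \<star> (g \<odot>\<^bsub>A\<^esub> f) = (F \<star> g) \<odot>\<^bsub>B\<^esub> (F \<star> f)"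

definition id_func :: "('o, 'm, 'o, 'm) func"
  where "id_func = \<lparr>obj_map = (\<lambda>X. X), arr_map = (\<lambda>f. f)\<rparr>"

definition comp_func ::
    "('p, 'n, 'q, 'l) func \<Rightarrow> ('o, 'm, 'p, 'n) func \<Rightarrow> ('o, 'm, 'q, 'l) func"  (infixr "\<bullet>" 80)
  where "F \<bullet> G = \<lparr>obj_map = (\<lambda>X. F \<cdot> G \<cdot> X), arr_map = (\<lambda>f. F \<star> G \<star> f)\<rparr>"

lemma func_simps [simp]:
  "id_func \<cdot> X = X" "id_func \<star> f = f" "(F \<bullet> G) \<cdot> X = F \<cdot> G \<cdot> X" "(F \<bullet> G) \<star> f = F \<star> G \<star> f"
  by (simp_all add: id_func_def comp_func_def)

lemma is_functor_comp:
  assumes "is_functor A B G" "is_functor B C F" shows "is_functor A C (F \<bullet> G)"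
proof -
  interpret G: is_functor A B G by fact
  interpret F: is_functor B C F by fact
  show ?thesis
    by unfold_locales (auto simp: G.map_obj F.map_obj G.map_id F.map_id G.map_comp
      F.map_comp[OF G.map_hom G.map_hom] intro: F.map_hom G.map_hom)
qed

locale nat_trans = F: is_functor A B F + G: is_functor A B G
  for A :: "('o, 'm) cat" and B :: "('p, 'n) cat"
    and F G :: "('o, 'm, 'p, 'n) func" and \<tau> :: "'o \<Rightarrow> 'n" +
  assumes component: "X \<in> Obj A \<Longrightarrow> \<tau> X \<in> hom B (F \<cdot> X) (G \<cdot> X)"
    and naturality: "f \<in> hom A X Y \<Longrightarrow> (G \<star> f) \<odot>\<^bsub>B\<^esub> \<tau> X = \<tau> Y \<odot>\<^bsub>B\<^esub> (F \<star> f)"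


section \<open>Equalizers and adjunctions\<close>

definition is_equalizer :: "('o, 'm) cat \<Rightarrow> 'm \<Rightarrow> 'm \<Rightarrow> 'o \<Rightarrow> 'm \<Rightarrow> bool"
  where "is_equalizer C f g E e \<longleftrightarrow>
    (\<exists>X Y. f \<in> hom C X Y \<and> g \<in> hom C X Y \<and> e \<in> hom C E X \<and>
      f \<odot>\<^bsub>C\<^esub> e = g \<odot>\<^bsub>C\<^esub> e \<and>
      (\<forall>Z h. h \<in> hom C Z X \<and> f \<odot>\<^bsub>C\<^esub> h = g \<odot>\<^bsub>C\<^esub> h \<longrightarrow>
        (\<exists>!k. k \<in> hom C Z E \<and> e \<odot>\<^bsub>C\<^esub> k = h)))"

locale adjunction = L: is_functor B A L + R: is_functor A B R +
    unit: nat_trans B B id_func "R \<bullet> L" \<eta> + counit: nat_trans A A "L \<bullet> R" id_func \<epsilon>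
  for B :: "('p, 'n) cat" and A :: "('o, 'm) cat"
    and L :: "('p, 'n, 'o, 'm) func" and R :: "('o, 'm, 'p, 'n) func"
    and \<eta> :: "'p \<Rightarrow> 'n" and \<epsilon> :: "'o \<Rightarrow> 'm" +
  assumes triangle_L: "Y \<in> Obj B \<Longrightarrow> \<epsilon> (L \<cdot> Y) \<odot>\<^bsub>A\<^esub> (L \<star> \<eta> Y) = Ide A (L \<cdot> Y)"
    and triangle_R: "X \<in> Obj A \<Longrightarrow> (R \<star> \<epsilon> X) \<odot>\<^bsub>B\<^esub> \<eta> (R \<cdot> X) = Ide B (R \<cdot> X)"

definition right_adjoint ::
    "('p, 'n) cat \<Rightarrow> ('o, 'm) cat \<Rightarrow> ('p, 'n, 'o, 'm) func \<Rightarrow> ('o, 'm, 'p, 'n) func \<Rightarrow> bool"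
  where "right_adjoint B A L R \<longleftrightarrow> (\<exists>\<eta> \<epsilon>. adjunction B A L R \<eta> \<epsilon>)"


section \<open>Comonads and their coalgebras\<close>

locale comonad = comult: nat_trans A A G "G \<bullet> G" \<Delta> + counit: nat_trans A A G id_func \<epsilon>
  for A :: "('o, 'm) cat" and G :: "('o, 'm, 'o, 'm) func"
    and \<Delta> :: "'o \<Rightarrow> 'm" and \<epsilon> :: "'o \<Rightarrow> 'm" +
  assumes coassoc: "X \<in> Obj A \<Longrightarrow> (G \<star> \<Delta> X) \<odot>\<^bsub>A\<^esub> \<Delta> X = \<Delta> (G \<cdot> X) \<odot>\<^bsub>A\<^esub> \<Delta> X"
    and counit_left: "X \<in> Obj A \<Longrightarrow> \<epsilon> (G \<cdot> X) \<odot>\<^bsub>A\<^esub> \<Delta> X = Ide A (G \<cdot> X)"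
    and counit_right: "X \<in> Obj A \<Longrightarrow> (G \<star> \<epsilon> X) \<odot>\<^bsub>A\<^esub> \<Delta> X = Ide A (G \<cdot> X)"

locale comonad_morphism = source: comonad A H \<delta> \<epsilon>\<^sub>H + target: comonad A G \<Delta> \<epsilon>\<^sub>G +
    nat_trans A A H G \<phi>
  for A :: "('o, 'm) cat"
    and H :: "('o, 'm, 'o, 'm) func" and \<delta> :: "'o \<Rightarrow> 'm" and \<epsilon>\<^sub>H :: "'o \<Rightarrow> 'm"
    and G :: "('o, 'm, 'o, 'm) func" and \<Delta> :: "'o \<Rightarrow> 'm" and \<epsilon>\<^sub>G :: "'o \<Rightarrow> 'm"
    and \<phi> :: "'o \<Rightarrow> 'm" +
  assumes comult_compat: "X \<in> Obj A \<Longrightarrow>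
      \<Delta> X \<odot>\<^bsub>A\<^esub> \<phi> X = (\<phi> (G \<cdot> X) \<odot>\<^bsub>A\<^esub> (H \<star> \<phi> X)) \<odot>\<^bsub>A\<^esub> \<delta> X"
    and counit_compat: "X \<in> Obj A \<Longrightarrow> \<epsilon>\<^sub>G X \<odot>\<^bsub>A\<^esub> \<phi> X = \<epsilon>\<^sub>H X"

definition adj_comult ::
    "('p, 'n, 'o, 'm) func \<Rightarrow> ('o, 'm, 'p, 'n) func \<Rightarrow> ('p \<Rightarrow> 'n) \<Rightarrow> 'o \<Rightarrow> 'm"
  where "adj_comult L R \<eta> X = L \<star> \<eta> (R \<cdot> X)"

text \<open>By the following lemma, requiring the source of a comonad morphism out of \<^term>\<open>L \<bullet> R\<close> to be a
  comonad adds
  nothing to the adjunction.\<close>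

lemma adjunction_comonad:
  assumes "adjunction B A L R \<eta> \<epsilon>"
  shows "comonad A (L \<bullet> R) (adj_comult L R \<eta>) \<epsilon>"
proof -
  interpret adjunction B A L R \<eta> \<epsilon> by fact
  interpret LR: is_functor A A "L \<bullet> R" by (rule is_functor_comp) unfold_locales
  interpret LRLR: is_functor A A "(L \<bullet> R) \<bullet> (L \<bullet> R)" by (rule is_functor_comp) unfold_locales
  have eta: "\<eta> Y \<in> hom B Y (R \<cdot> L \<cdot> Y)" if "Y \<in> Obj B" for Y using unit.component[OF that] by simp
  have eps: "\<epsilon> X \<in> hom A (L \<cdot> R \<cdot> X) X" if "X \<in> Obj A" for X using counit.component[OF that] by simp
  show ?thesis
  proof unfold_locales
    fix X assume X: "X \<in> Obj A"
    then have RX: "R \<cdot> X \<in> Obj B" by (rule R.map_obj)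
    then have LRX: "L \<cdot> R \<cdot> X \<in> Obj A" by (rule L.map_obj)
    show "adj_comult L R \<eta> X \<in> hom A ((L \<bullet> R) \<cdot> X) (((L \<bullet> R) \<bullet> L \<bullet> R) \<cdot> X)"
      using L.map_hom[OF eta[OF RX]] by (simp add: adj_comult_def)
    have "R \<star> L \<star> \<eta> (R \<cdot> X) \<odot>\<^bsub>B\<^esub> \<eta> (R \<cdot> X) = \<eta> (R \<cdot> L \<cdot> R \<cdot> X) \<odot>\<^bsub>B\<^esub> \<eta> (R \<cdot> X)"
      using unit.naturality[OF eta[OF RX]] by simp
    then show "(L \<bullet> R) \<star> adj_comult L R \<eta> X \<odot>\<^bsub>A\<^esub> adj_comult L R \<eta> X =
         adj_comult L R \<eta> ((L \<bullet> R) \<cdot> X) \<odot>\<^bsub>A\<^esub> adj_comult L R \<eta> X"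
      using L.map_comp[OF eta[OF RX] R.map_hom[OF L.map_hom[OF eta[OF RX]]]]
        L.map_comp[OF eta[OF RX] eta[OF R.map_obj[OF LRX]]]
      by (simp add: adj_comult_def)
    show "\<epsilon> ((L \<bullet> R) \<cdot> X) \<odot>\<^bsub>A\<^esub> adj_comult L R \<eta> X = Ide A ((L \<bullet> R) \<cdot> X)"
      using triangle_L[OF RX] by (simp add: adj_comult_def)
    show "(L \<bullet> R) \<star> \<epsilon> X \<odot>\<^bsub>A\<^esub> adj_comult L R \<eta> X = Ide A ((L \<bullet> R) \<cdot> X)"
      using L.map_comp[OF eta[OF RX] R.map_hom[OF eps[OF X]]] triangle_R[OF X] L.map_id[OF RX]
      by (simp add: adj_comult_def)
  next
    fix f X Y assume f: "f \<in> hom A X Y"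
    then have XY: "X \<in> Obj A" "Y \<in> Obj A"
      using L.B.dom_obj L.B.cod_obj by (auto simp: hom_def)
    show "((L \<bullet> R) \<bullet> L \<bullet> R) \<star> f \<odot>\<^bsub>A\<^esub> adj_comult L R \<eta> X =
         adj_comult L R \<eta> Y \<odot>\<^bsub>A\<^esub> (L \<bullet> R) \<star> f"
      using unit.naturality[OF R.map_hom[OF f]]
        L.map_comp[OF eta[OF R.map_obj[OF XY(1)]] R.map_hom[OF L.map_hom[OF R.map_hom[OF f]]]]
        L.map_comp[OF R.map_hom[OF f] eta[OF R.map_obj[OF XY(2)]]]
      by (simp add: adj_comult_def)
  qed
qed
definition is_coalgebra ::
    "('o, 'm) cat \<Rightarrow> ('o, 'm, 'o, 'm) func \<Rightarrow> ('o \<Rightarrow> 'm) \<Rightarrow> ('o \<Rightarrow> 'm) \<Rightarrow> 'o \<Rightarrow> 'm \<Rightarrow> bool"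
  where "is_coalgebra A G \<Delta> \<epsilon> X x \<longleftrightarrow>
    X \<in> Obj A \<and> x \<in> hom A X (G \<cdot> X) \<and>
    (G \<star> x) \<odot>\<^bsub>A\<^esub> x = \<Delta> X \<odot>\<^bsub>A\<^esub> x \<and> \<epsilon> X \<odot>\<^bsub>A\<^esub> x = Ide A X"

text \<open>The same arrow of \<^term>\<open>A\<close> may underlie morphisms between different coalgebras, so an arrow of
  the category of coalgebras is a triple consisting of source, underlying arrow and target.\<close>

type_synonym ('o, 'm) coalg_arr = "('o \<times> 'm) \<times> 'm \<times> ('o \<times> 'm)"

definition coalg_cat ::
    "('o, 'm) cat \<Rightarrow> ('o, 'm, 'o, 'm) func \<Rightarrow> ('o \<Rightarrow> 'm) \<Rightarrow> ('o \<Rightarrow> 'm) \<Rightarrow>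
      ('o \<times> 'm, ('o, 'm) coalg_arr) cat"
  where "coalg_cat A G \<Delta> \<epsilon> =
    \<lparr>Obj = {(X, x). is_coalgebra A G \<Delta> \<epsilon> X x},
     Arr = {((X, x), f, (X', x')).
       is_coalgebra A G \<Delta> \<epsilon> X x \<and> is_coalgebra A G \<Delta> \<epsilon> X' x' \<and>
       f \<in> hom A X X' \<and> (G \<star> f) \<odot>\<^bsub>A\<^esub> x = x' \<odot>\<^bsub>A\<^esub> f},
     Dom = (\<lambda>(S, f, T). S),
     Cod = (\<lambda>(S, f, T). T),
     Ide = (\<lambda>(X, x). ((X, x), Ide A X, (X, x))),
     Comp = (\<lambda>(S', g, T') (S, f, T). (S, g \<odot>\<^bsub>A\<^esub> f, T'))\<rparr>"

definition forgetful :: "('o \<times> 'm, ('o, 'm) coalg_arr, 'o, 'm) func"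
  where "forgetful = \<lparr>obj_map = (\<lambda>(X, x). X), arr_map = (\<lambda>(S, f, T). f)\<rparr>"


section \<open>The comparison functor of a comonad morphism\<close>

definition comparison_obj ::
    "('o, 'm) cat \<Rightarrow> ('p, 'n, 'o, 'm) func \<Rightarrow> ('p \<Rightarrow> 'n) \<Rightarrow> ('o \<Rightarrow> 'm) \<Rightarrow> 'p \<Rightarrow> 'o \<times> 'm"
  where "comparison_obj A L \<eta> \<phi> Y = (L \<cdot> Y, \<phi> (L \<cdot> Y) \<odot>\<^bsub>A\<^esub> (L \<star> \<eta> Y))"

definition comparison ::
    "('p, 'n) cat \<Rightarrow> ('o, 'm) cat \<Rightarrow> ('p, 'n, 'o, 'm) func \<Rightarrow> ('p \<Rightarrow> 'n) \<Rightarrow> ('o \<Rightarrow> 'm) \<Rightarrow>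
      ('p, 'n, 'o \<times> 'm, ('o, 'm) coalg_arr) func"
  where "comparison B A L \<eta> \<phi> =
    \<lparr>obj_map = comparison_obj A L \<eta> \<phi>,
     arr_map = (\<lambda>f. (comparison_obj A L \<eta> \<phi> (Dom B f), L \<star> f, comparison_obj A L \<eta> \<phi> (Cod B f)))\<rparr>"

definition mate ::
    "('p, 'n) cat \<Rightarrow> ('o, 'm, 'p, 'n) func \<Rightarrow> ('p \<Rightarrow> 'n) \<Rightarrow> ('o \<Rightarrow> 'm) \<Rightarrow> 'o \<Rightarrow> 'n"
  where "mate B R \<eta> \<phi> X = (R \<star> \<phi> X) \<odot>\<^bsub>B\<^esub> \<eta> (R \<cdot> X)"

end

theory Submission
  imports Defs
begin

text \<open>The theorem is a statement about transposition. Under the adjunction \<open>L \<stileturn> R\<close>, with counit \<open>\<epsilon>\<close>, an arrow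
  \<open>h: Y \<rightarrow> RX\<close> corresponds to \<open>f = \<epsilon>\<^sub>X \<circ> Lh: LY \<rightarrow> X\<close>. The arrow \<open>x \<circ> f\<close> is the transpose
  of \<open>Rx \<circ> h\<close>, and naturality of \<open>\<phi>\<close> makes \<open>Gf \<circ> \<phi>\<^sub>L\<^sub>Y \<circ> L\<eta>\<^sub>Y\<close> the transpose of \<open>\<alpha>\<^sub>X \<circ> h\<close>. Hence
  \<open>f\<close> is a morphism of coalgebras from \<open>K\<^sub>\<phi>Y\<close> to \<open>(X, x)\<close> exactly when \<open>h\<close> equalizes \<open>\<alpha>\<^sub>X\<close>
  and \<open>Rx\<close> (\<open>coalgebra_morphism_iff_equalizes\<close>), that is, when \<open>h\<close> factors through the equalizer. So
  arrows \<open>Y \<rightarrow> D\<^sub>\<phi>X\<close> correspond to morphisms \<open>K\<^sub>\<phi>Y \<rightarrow> (X, x)\<close>; in other words,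
  \<open>\<epsilon>\<^sub>X \<circ> L eq\<^sub>X\<close> is a universal arrow from \<open>K\<^sub>\<phi>\<close> to \<open>(X, x)\<close>.

  A choice of universal arrows is the same thing as a right adjoint (\<open>universal_arrows.adjunction\<close>), and
  transposing the equation that characterizes \<open>D\<^sub>\<phi>\<close> on arrows shows that the \<open>eq\<^sub>X\<close> are natural. That
  \<open>\<phi>\<close> respects comultiplications and counits is what makes \<open>K\<^sub>\<phi>Y\<close> a coalgebra
  (\<open>comparison_coalgebra\<close>).\<close>

section \<open>Right adjoints from universal arrows\<close>

lemma (in category) hom_obj:
  assumes "f \<in> hom C X Y" shows "X \<in> Obj C" "Y \<in> Obj C"
  using assms dom_obj cod_obj by (auto simp: hom_def)

locale universal_arrows = K: is_functor B C K
  for B :: "('p, 'n) cat" and C :: "('o, 'm) cat" and K :: "('p, 'n, 'o, 'm) func" +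
  fixes D\<^sub>0 :: "'o \<Rightarrow> 'p" and u :: "'o \<Rightarrow> 'm"
  assumes D\<^sub>0_obj: "S \<in> Obj C \<Longrightarrow> D\<^sub>0 S \<in> Obj B"
    and arrow_hom: "S \<in> Obj C \<Longrightarrow> u S \<in> hom C (K \<cdot> D\<^sub>0 S) S"
    and universal: "S \<in> Obj C \<Longrightarrow> Y \<in> Obj B \<Longrightarrow> g \<in> hom C (K \<cdot> Y) S \<Longrightarrow>
      \<exists>!k. k \<in> hom B Y (D\<^sub>0 S) \<and> u S \<odot>\<^bsub>C\<^esub> (K \<star> k) = g"
begin

definition factor :: "'p \<Rightarrow> 'o \<Rightarrow> 'm \<Rightarrow> 'n"
  where "factor Y S g = (THE k. k \<in> hom B Y (D\<^sub>0 S) \<and> u S \<odot>\<^bsub>C\<^esub> (K \<star> k) = g)"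

lemma factor:
  assumes "S \<in> Obj C" "Y \<in> Obj B" "g \<in> hom C (K \<cdot> Y) S"
  shows "factor Y S g \<in> hom B Y (D\<^sub>0 S)" "u S \<odot>\<^bsub>C\<^esub> (K \<star> factor Y S g) = g"
  using theI'[OF universal[OF assms]] by (simp_all add: factor_def)

lemma factor_unique:
  assumes S: "S \<in> Obj C" and k: "k \<in> hom B Y (D\<^sub>0 S)" and k': "k' \<in> hom B Y (D\<^sub>0 S)"
    and eq: "u S \<odot>\<^bsub>C\<^esub> (K \<star> k) = u S \<odot>\<^bsub>C\<^esub> (K \<star> k')"
  shows "k = k'"
proof -
  have "u S \<odot>\<^bsub>C\<^esub> (K \<star> k') \<in> hom C (K \<cdot> Y) S"
    using K.B.comp_hom[OF K.map_hom[OF k'] arrow_hom[OF S]] .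
  from universal[OF S K.A.hom_obj(1)[OF k] this] show ?thesis using k k' eq by blast
qed

definition D :: "('o, 'm, 'p, 'n) func"
  where "D = \<lparr>obj_map = D\<^sub>0,
    arr_map = (\<lambda>g. factor (D\<^sub>0 (Dom C g)) (Cod C g) (g \<odot>\<^bsub>C\<^esub> u (Dom C g)))\<rparr>"

lemma D_obj [simp]: "D \<cdot> S = D\<^sub>0 S"
  by (simp add: D_def)

lemma D_arr:
  assumes "g \<in> hom C S T"
  shows "D \<star> g \<in> hom B (D\<^sub>0 S) (D\<^sub>0 T)" "u T \<odot>\<^bsub>C\<^esub> (K \<star> D \<star> g) = g \<odot>\<^bsub>C\<^esub> u S"
proof -
  have S: "S \<in> Obj C" and T: "T \<in> Obj C" using K.B.hom_obj[OF assms] .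
  have "D \<star> g = factor (D\<^sub>0 S) T (g \<odot>\<^bsub>C\<^esub> u S)" using assms by (simp add: D_def hom_def)
  with factor[OF T D\<^sub>0_obj[OF S] K.B.comp_hom[OF arrow_hom[OF S] assms]]
  show "D \<star> g \<in> hom B (D\<^sub>0 S) (D\<^sub>0 T)" "u T \<odot>\<^bsub>C\<^esub> (K \<star> D \<star> g) = g \<odot>\<^bsub>C\<^esub> u S" by simp_all
qed

text \<open>Every equation between arrows into \<open>D\<^sub>0 S\<close> below is checked after composing the images under \<open>K\<close> with
  the universal arrow, where it follows from the equation that defines the factorization.\<close>

lemma D_functor: "is_functor C B D"
proof unfold_locales
  fix S assume S: "S \<in> Obj C"
  then show "D \<cdot> S \<in> Obj B" by (simp add: D\<^sub>0_obj)
  have i: "Ide C S \<in> hom C S S" by (rule K.B.id_hom[OF S])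
  show "D \<star> Ide C S = Ide B (D \<cdot> S)"
    using factor_unique[OF S D_arr(1)[OF i] K.A.id_hom[OF D\<^sub>0_obj[OF S]]] D_arr(2)[OF i]
      K.B.id_left[OF arrow_hom[OF S]] K.B.id_right[OF arrow_hom[OF S]] K.map_id[OF D\<^sub>0_obj[OF S]]
    by simp
next
  fix g S T assume "g \<in> hom C S T"
  then show "D \<star> g \<in> hom B (D \<cdot> S) (D \<cdot> T)" by (simp add: D_arr)
next
  fix g S T h U assume g: "g \<in> hom C S T" and h: "h \<in> hom C T U"
  have S: "S \<in> Obj C" and T: "T \<in> Obj C" and U: "U \<in> Obj C"
    using K.B.hom_obj[OF g] K.B.hom_obj[OF h] by auto
  note hg = K.B.comp_hom[OF g h]
  note Dg = D_arr[OF g] and Dh = D_arr[OF h]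
  have "u U \<odot>\<^bsub>C\<^esub> (K \<star> ((D \<star> h) \<odot>\<^bsub>B\<^esub> (D \<star> g)))
      = (u U \<odot>\<^bsub>C\<^esub> (K \<star> D \<star> h)) \<odot>\<^bsub>C\<^esub> (K \<star> D \<star> g)"
    by (simp add: K.map_comp[OF Dg(1) Dh(1)]
      K.B.comp_assoc[OF K.map_hom[OF Dg(1)] K.map_hom[OF Dh(1)] arrow_hom[OF U]])
  also have "\<dots> = h \<odot>\<^bsub>C\<^esub> (u T \<odot>\<^bsub>C\<^esub> (K \<star> D \<star> g))"
    by (simp add: Dh(2) K.B.comp_assoc[OF K.map_hom[OF Dg(1)] arrow_hom[OF T] h])
  also have "\<dots> = u U \<odot>\<^bsub>C\<^esub> (K \<star> D \<star> (h \<odot>\<^bsub>C\<^esub> g))"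
    by (simp add: Dg(2) D_arr(2)[OF hg] K.B.comp_assoc[OF arrow_hom[OF S] g h])
  finally show "D \<star> (h \<odot>\<^bsub>C\<^esub> g) = (D \<star> h) \<odot>\<^bsub>B\<^esub> (D \<star> g)"
    using factor_unique[OF U D_arr(1)[OF hg] K.A.comp_hom[OF Dg(1) Dh(1)]] by simp
qed

definition unit :: "'p \<Rightarrow> 'n"
  where "unit Y = factor Y (K \<cdot> Y) (Ide C (K \<cdot> Y))"

lemma unit:
  assumes "Y \<in> Obj B"
  shows "unit Y \<in> hom B Y (D\<^sub>0 (K \<cdot> Y))" "u (K \<cdot> Y) \<odot>\<^bsub>C\<^esub> (K \<star> unit Y) = Ide C (K \<cdot> Y)"
  using factor[OF K.map_obj[OF assms] assms K.B.id_hom[OF K.map_obj[OF assms]]]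
  by (simp_all add: unit_def)

theorem adjunction: "adjunction B C K D unit u"
proof -
  interpret D: is_functor C B D by (rule D_functor)
  interpret DK: is_functor B B "D \<bullet> K" by (rule is_functor_comp) unfold_locales
  interpret KD: is_functor C C "K \<bullet> D" by (rule is_functor_comp) unfold_locales
  show ?thesis
  proof unfold_locales
    fix Y assume Y: "Y \<in> Obj B"
    then show "id_func \<cdot> Y \<in> Obj B" by simp
    show "unit Y \<in> hom B (id_func \<cdot> Y) ((D \<bullet> K) \<cdot> Y)" using unit(1)[OF Y] by simp
    show "u (K \<cdot> Y) \<odot>\<^bsub>C\<^esub> (K \<star> unit Y) = Ide C (K \<cdot> Y)" by (rule unit(2)[OF Y])
    show "id_func \<star> Ide B Y = Ide B (id_func \<cdot> Y)" by simp
  next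
    fix f Y Z assume f: "f \<in> hom B Y Z"
    then show "id_func \<star> f \<in> hom B (id_func \<cdot> Y) (id_func \<cdot> Z)" by simp
    have Y: "Y \<in> Obj B" and Z: "Z \<in> Obj B" using K.A.hom_obj[OF f] .
    note Kf = K.map_hom[OF f]
    note KY = K.map_obj[OF Y] and KZ = K.map_obj[OF Z]
    note DKf = D_arr[OF Kf]
    have "u (K \<cdot> Z) \<odot>\<^bsub>C\<^esub> (K \<star> ((D \<star> K \<star> f) \<odot>\<^bsub>B\<^esub> unit Y))
        = (u (K \<cdot> Z) \<odot>\<^bsub>C\<^esub> (K \<star> D \<star> K \<star> f)) \<odot>\<^bsub>C\<^esub> (K \<star> unit Y)"
      by (simp add: K.map_comp[OF unit(1)[OF Y] DKf(1)]
        K.B.comp_assoc[OF K.map_hom[OF unit(1)[OF Y]] K.map_hom[OF DKf(1)] arrow_hom[OF KZ]])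
    also have "\<dots> = K \<star> f"
      by (simp add: DKf(2) unit(2)[OF Y] K.B.id_right[OF Kf]
        K.B.comp_assoc[OF K.map_hom[OF unit(1)[OF Y]] arrow_hom[OF KY] Kf])
    also have "\<dots> = (u (K \<cdot> Z) \<odot>\<^bsub>C\<^esub> (K \<star> unit Z)) \<odot>\<^bsub>C\<^esub> (K \<star> f)"
      by (simp add: unit(2)[OF Z] K.B.id_left[OF Kf])
    also have "\<dots> = u (K \<cdot> Z) \<odot>\<^bsub>C\<^esub> (K \<star> (unit Z \<odot>\<^bsub>B\<^esub> f))"
      by (simp add: K.map_comp[OF f unit(1)[OF Z]]
        K.B.comp_assoc[OF Kf K.map_hom[OF unit(1)[OF Z]] arrow_hom[OF KZ]])
    finally show "((D \<bullet> K) \<star> f) \<odot>\<^bsub>B\<^esub> unit Y = unit Z \<odot>\<^bsub>B\<^esub> (id_func \<star> f)"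
      using factor_unique[OF KZ K.A.comp_hom[OF unit(1)[OF Y] DKf(1)]
        K.A.comp_hom[OF f unit(1)[OF Z]]] by simp
  next
    fix S assume S: "S \<in> Obj C"
    then show "id_func \<cdot> S \<in> Obj C" by simp
    show "u S \<in> hom C ((K \<bullet> D) \<cdot> S) (id_func \<cdot> S)" using arrow_hom[OF S] by simp
    show "id_func \<star> Ide C S = Ide C (id_func \<cdot> S)" by simp
    note DS = D\<^sub>0_obj[OF S] and uS = arrow_hom[OF S]
    note KDS = K.map_obj[OF DS]
    note un = unit[OF DS]
    have "u S \<odot>\<^bsub>C\<^esub> (K \<star> ((D \<star> u S) \<odot>\<^bsub>B\<^esub> unit (D\<^sub>0 S)))
        = (u S \<odot>\<^bsub>C\<^esub> (K \<star> D \<star> u S)) \<odot>\<^bsub>C\<^esub> (K \<star> unit (D\<^sub>0 S))"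
      by (simp add: K.map_comp[OF un(1) D_arr(1)[OF uS]]
        K.B.comp_assoc[OF K.map_hom[OF un(1)] K.map_hom[OF D_arr(1)[OF uS]] uS])
    also have "\<dots> = u S \<odot>\<^bsub>C\<^esub> (K \<star> Ide B (D\<^sub>0 S))"
      by (simp add: D_arr(2)[OF uS] K.B.comp_assoc[OF K.map_hom[OF un(1)] arrow_hom[OF KDS] uS]
        un(2) K.map_id[OF DS])
    finally show "(D \<star> u S) \<odot>\<^bsub>B\<^esub> unit (D \<cdot> S) = Ide B (D \<cdot> S)"
      using factor_unique[OF S K.A.comp_hom[OF un(1) D_arr(1)[OF uS]] K.A.id_hom[OF DS]] by simp
  next
    fix g S T assume g: "g \<in> hom C S T"
    then show "id_func \<star> g \<in> hom C (id_func \<cdot> S) (id_func \<cdot> T)" by simp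
    show "(id_func \<star> g) \<odot>\<^bsub>C\<^esub> u S = u T \<odot>\<^bsub>C\<^esub> ((K \<bullet> D) \<star> g)" using D_arr(2)[OF g] by simp
  qed simp_all
qed

end

section \<open>Transposition\<close>

context adjunction
begin

lemma unit_hom: "Y \<in> Obj B \<Longrightarrow> \<eta> Y \<in> hom B Y (R \<cdot> L \<cdot> Y)"
  using unit.component by simp

lemma counit_hom: "X \<in> Obj A \<Longrightarrow> \<epsilon> X \<in> hom A (L \<cdot> R \<cdot> X) X"
  using counit.component by simp

lemma unit_naturality:
  "f \<in> hom B Y Z \<Longrightarrow> (R \<star> L \<star> f) \<odot>\<^bsub>B\<^esub> \<eta> Y = \<eta> Z \<odot>\<^bsub>B\<^esub> f"
  using unit.naturality by simp

lemma counit_naturality: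
  "f \<in> hom A X Y \<Longrightarrow> f \<odot>\<^bsub>A\<^esub> \<epsilon> X = \<epsilon> Y \<odot>\<^bsub>A\<^esub> (L \<star> R \<star> f)"
  using counit.naturality by simp

definition flat :: "'p \<Rightarrow> 'm \<Rightarrow> 'n"
  where "flat Y f = (R \<star> f) \<odot>\<^bsub>B\<^esub> \<eta> Y"

definition sharp :: "'o \<Rightarrow> 'n \<Rightarrow> 'm"
  where "sharp X h = \<epsilon> X \<odot>\<^bsub>A\<^esub> (L \<star> h)"

lemma flat_hom:
  assumes "Y \<in> Obj B" "f \<in> hom A (L \<cdot> Y) X" shows "flat Y f \<in> hom B Y (R \<cdot> X)"
  unfolding flat_def using L.A.comp_hom[OF unit_hom[OF assms(1)] R.map_hom[OF assms(2)]] .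

lemma sharp_hom:
  assumes "X \<in> Obj A" "h \<in> hom B Y (R \<cdot> X)" shows "sharp X h \<in> hom A (L \<cdot> Y) X"
  unfolding sharp_def using L.B.comp_hom[OF L.map_hom[OF assms(2)] counit_hom[OF assms(1)]] .

lemma flat_sharp:
  assumes X: "X \<in> Obj A" and h: "h \<in> hom B Y (R \<cdot> X)"
  shows "flat Y (sharp X h) = h"
proof -
  have Y: "Y \<in> Obj B" using L.A.hom_obj(1)[OF h] .
  note Lh = L.map_hom[OF h]
  have "flat Y (sharp X h) = (R \<star> \<epsilon> X) \<odot>\<^bsub>B\<^esub> ((R \<star> L \<star> h) \<odot>\<^bsub>B\<^esub> \<eta> Y)"
    by (simp add: flat_def sharp_def R.map_comp[OF Lh counit_hom[OF X]]
      L.A.comp_assoc[OF unit_hom[OF Y] R.map_hom[OF Lh] R.map_hom[OF counit_hom[OF X]]])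
  also have "\<dots> = ((R \<star> \<epsilon> X) \<odot>\<^bsub>B\<^esub> \<eta> (R \<cdot> X)) \<odot>\<^bsub>B\<^esub> h"
    by (simp add: unit_naturality[OF h]
      L.A.comp_assoc[OF h unit_hom[OF R.map_obj[OF X]] R.map_hom[OF counit_hom[OF X]]])
  finally show ?thesis by (simp add: triangle_R[OF X] L.A.id_left[OF h])
qed

lemma sharp_flat:
  assumes Y: "Y \<in> Obj B" and f: "f \<in> hom A (L \<cdot> Y) X"
  shows "sharp X (flat Y f) = f"
proof -
  have X: "X \<in> Obj A" using L.B.hom_obj(2)[OF f] .
  note Rf = R.map_hom[OF f] and L\<eta> = L.map_hom[OF unit_hom[OF Y]]
  have "sharp X (flat Y f) = (\<epsilon> X \<odot>\<^bsub>A\<^esub> (L \<star> R \<star> f)) \<odot>\<^bsub>A\<^esub> (L \<star> \<eta> Y)"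
    by (simp add: flat_def sharp_def L.map_comp[OF unit_hom[OF Y] Rf]
      L.B.comp_assoc[OF L\<eta> L.map_hom[OF Rf] counit_hom[OF X]])
  also have "\<dots> = f \<odot>\<^bsub>A\<^esub> (\<epsilon> (L \<cdot> Y) \<odot>\<^bsub>A\<^esub> (L \<star> \<eta> Y))"
    by (simp add: counit_naturality[OF f, symmetric]
      L.B.comp_assoc[OF L\<eta> counit_hom[OF L.map_obj[OF Y]] f])
  finally show ?thesis by (simp add: triangle_L[OF Y] L.B.id_right[OF f])
qed

lemma flat_comp:
  assumes Y: "Y \<in> Obj B" and f: "f \<in> hom A (L \<cdot> Y) X" and g: "g \<in> hom A X Z"
  shows "flat Y (g \<odot>\<^bsub>A\<^esub> f) = (R \<star> g) \<odot>\<^bsub>B\<^esub> flat Y f"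
  by (simp add: flat_def R.map_comp[OF f g]
    L.A.comp_assoc[OF unit_hom[OF Y] R.map_hom[OF f] R.map_hom[OF g]])

lemma sharp_comp:
  assumes X: "X \<in> Obj A" and k: "k \<in> hom B Y Z" and h: "h \<in> hom B Z (R \<cdot> X)"
  shows "sharp X (h \<odot>\<^bsub>B\<^esub> k) = sharp X h \<odot>\<^bsub>A\<^esub> (L \<star> k)"
  by (simp add: sharp_def L.map_comp[OF k h]
    L.B.comp_assoc[OF L.map_hom[OF k] L.map_hom[OF h] counit_hom[OF X]])

lemma flat_sharp_comp:
  assumes X: "X \<in> Obj A" and h: "h \<in> hom B Y (R \<cdot> X)" and g: "g \<in> hom A X Z"
  shows "flat Y (g \<odot>\<^bsub>A\<^esub> sharp X h) = (R \<star> g) \<odot>\<^bsub>B\<^esub> h"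
  by (simp add: flat_comp[OF L.A.hom_obj(1)[OF h] sharp_hom[OF X h] g] flat_sharp[OF X h])

lemma flat_eq_iff:
  assumes Y: "Y \<in> Obj B" and f: "f \<in> hom A (L \<cdot> Y) X" "g \<in> hom A (L \<cdot> Y) X"
  shows "flat Y f = flat Y g \<longleftrightarrow> f = g"
  using sharp_flat[OF Y f(1)] sharp_flat[OF Y f(2)] by metis

lemma sharp_eq_iff:
  assumes X: "X \<in> Obj A" and h: "h \<in> hom B Y (R \<cdot> X)" "k \<in> hom B Y (R \<cdot> X)"
  shows "sharp X h = sharp X k \<longleftrightarrow> h = k"
  using flat_sharp[OF X h(1)] flat_sharp[OF X h(2)] by metis

end


section \<open>The category of coalgebras\<close>

lemma hom_coalg_cat_iff:
  "g \<in> hom (coalg_cat A G \<Delta> \<epsilon>) (X, x) (X', x') \<longleftrightarrow>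
    is_coalgebra A G \<Delta> \<epsilon> X x \<and> is_coalgebra A G \<Delta> \<epsilon> X' x' \<and>
    (\<exists>f. g = ((X, x), f, (X', x')) \<and> f \<in> hom A X X' \<and> (G \<star> f) \<odot>\<^bsub>A\<^esub> x = x' \<odot>\<^bsub>A\<^esub> f)"
  by (auto simp: hom_def coalg_cat_def)

lemma Obj_coalg_cat_iff: "(X, x) \<in> Obj (coalg_cat A G \<Delta> \<epsilon>) \<longleftrightarrow> is_coalgebra A G \<Delta> \<epsilon> X x"
  by (simp add: coalg_cat_def)

lemma Comp_coalg_cat: "(T, g, U) \<odot>\<^bsub>coalg_cat A G \<Delta> \<epsilon>\<^esub> (S, f, T') = (S, g \<odot>\<^bsub>A\<^esub> f, U)"
  by (simp add: coalg_cat_def)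

lemma Ide_coalg_cat: "Ide (coalg_cat A G \<Delta> \<epsilon>) (X, x) = ((X, x), Ide A X, (X, x))"
  by (simp add: coalg_cat_def)

lemma is_coalgebraD:
  assumes "is_coalgebra A G \<Delta> \<epsilon> X x" shows "X \<in> Obj A" "x \<in> hom A X (G \<cdot> X)"
  using assms by (simp_all add: is_coalgebra_def)

context comonad
begin

lemma coalg_category: "category (coalg_cat A G \<Delta> \<epsilon>)" (is "category ?C")
proof
  fix f assume "f \<in> Arr ?C"
  then show "Dom ?C f \<in> Obj ?C" "Cod ?C f \<in> Obj ?C" by (auto simp: coalg_cat_def)
next
  fix S assume "S \<in> Obj ?C"
  then obtain X x where S: "S = (X, x)" and c: "is_coalgebra A G \<Delta> \<epsilon> X x"
    by (auto simp: coalg_cat_def)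
  note X = is_coalgebraD(1)[OF c] and x = is_coalgebraD(2)[OF c]
  show "Ide ?C S \<in> hom ?C S S"
    by (simp add: S Ide_coalg_cat hom_coalg_cat_iff c comult.F.A.id_hom[OF X] comult.F.map_id[OF X]
      comult.F.A.id_left[OF x] comult.F.A.id_right[OF x])
next
  fix f S T assume f: "f \<in> hom ?C S T"
  obtain X x Y y where [simp]: "S = (X, x)" "T = (Y, y)" by (cases S, cases T)
  from f obtain f' where [simp]: "f = ((X, x), f', (Y, y))" and "f' \<in> hom A X Y"
    by (auto simp: hom_coalg_cat_iff)
  then show "Ide ?C T \<odot>\<^bsub>?C\<^esub> f = f" "f \<odot>\<^bsub>?C\<^esub> Ide ?C S = f"
    by (simp_all add: Ide_coalg_cat Comp_coalg_cat comult.F.A.id_left comult.F.A.id_right)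
next
  fix f S T g U assume f: "f \<in> hom ?C S T" and g: "g \<in> hom ?C T U"
  obtain X x Y y Z z where [simp]: "S = (X, x)" "T = (Y, y)" "U = (Z, z)"
    by (cases S, cases T, cases U)
  from f obtain f' where [simp]: "f = ((X, x), f', (Y, y))" and f': "f' \<in> hom A X Y"
    and x: "is_coalgebra A G \<Delta> \<epsilon> X x" and ef: "(G \<star> f') \<odot>\<^bsub>A\<^esub> x = y \<odot>\<^bsub>A\<^esub> f'"
    by (auto simp: hom_coalg_cat_iff)
  from g obtain g' where [simp]: "g = ((Y, y), g', (Z, z))" and g': "g' \<in> hom A Y Z"
    and y: "is_coalgebra A G \<Delta> \<epsilon> Y y" and z: "is_coalgebra A G \<Delta> \<epsilon> Z z"
    and eg: "(G \<star> g') \<odot>\<^bsub>A\<^esub> y = z \<odot>\<^bsub>A\<^esub> g'"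
    by (auto simp: hom_coalg_cat_iff)
  note Gf = comult.F.map_hom[OF f'] and Gg = comult.F.map_hom[OF g']
  have "(G \<star> (g' \<odot>\<^bsub>A\<^esub> f')) \<odot>\<^bsub>A\<^esub> x = (G \<star> g') \<odot>\<^bsub>A\<^esub> (y \<odot>\<^bsub>A\<^esub> f')"
    by (simp add: comult.F.map_comp[OF f' g'] comult.F.A.comp_assoc[OF is_coalgebraD(2)[OF x] Gf Gg] ef)
  also have "\<dots> = ((G \<star> g') \<odot>\<^bsub>A\<^esub> y) \<odot>\<^bsub>A\<^esub> f'"
    by (simp add: comult.F.A.comp_assoc[OF f' is_coalgebraD(2)[OF y] Gg])
  also have "\<dots> = z \<odot>\<^bsub>A\<^esub> (g' \<odot>\<^bsub>A\<^esub> f')"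
    by (simp add: eg comult.F.A.comp_assoc[OF f' g' is_coalgebraD(2)[OF z]])
  finally show "g \<odot>\<^bsub>?C\<^esub> f \<in> hom ?C S U"
    using x z comult.F.A.comp_hom[OF f' g'] by (simp add: Comp_coalg_cat hom_coalg_cat_iff)
next
  fix f S T g U h V assume *: "f \<in> hom ?C S T" "g \<in> hom ?C T U" "h \<in> hom ?C U V"
  obtain X x Y y Z z W w where [simp]: "S = (X, x)" "T = (Y, y)" "U = (Z, z)" "V = (W, w)"
    by (cases S, cases T, cases U, cases V)
  from * show "(h \<odot>\<^bsub>?C\<^esub> g) \<odot>\<^bsub>?C\<^esub> f = h \<odot>\<^bsub>?C\<^esub> (g \<odot>\<^bsub>?C\<^esub> f)"
    by (auto simp: hom_coalg_cat_iff Comp_coalg_cat comult.F.A.comp_assoc)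
qed

lemma forgetful_functor: "is_functor (coalg_cat A G \<Delta> \<epsilon>) A forgetful"
proof -
  interpret C: category "coalg_cat A G \<Delta> \<epsilon>" by (rule coalg_category)
  show ?thesis
    by unfold_locales
      (auto simp: forgetful_def hom_coalg_cat_iff Obj_coalg_cat_iff Comp_coalg_cat Ide_coalg_cat
        dest: is_coalgebraD)
qed

end

section \<open>The comparison functor\<close>

locale adjunction_comonad_morphism = adjunction B A L R \<eta> \<epsilon>\<^sub>L\<^sub>R +
    phi: comonad_morphism A "L \<bullet> R" "adj_comult L R \<eta>" \<epsilon>\<^sub>L\<^sub>R G \<Delta> \<epsilon> \<phi>
  for B :: "('p, 'n) cat" and A :: "('o, 'm) cat"
    and L :: "('p, 'n, 'o, 'm) func" and R :: "('o, 'm, 'p, 'n) func"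
    and \<eta> :: "'p \<Rightarrow> 'n" and \<epsilon>\<^sub>L\<^sub>R :: "'o \<Rightarrow> 'm"
    and G :: "('o, 'm, 'o, 'm) func" and \<Delta> \<epsilon> \<phi> :: "'o \<Rightarrow> 'm"
begin

abbreviation coalg where "coalg \<equiv> coalg_cat A G \<Delta> \<epsilon>"
abbreviation K where "K \<equiv> comparison B A L \<eta> \<phi>"
abbreviation \<alpha> where "\<alpha> \<equiv> mate B R \<eta> \<phi>"

definition coact :: "'p \<Rightarrow> 'm"
  where "coact Y = \<phi> (L \<cdot> Y) \<odot>\<^bsub>A\<^esub> (L \<star> \<eta> Y)"

lemma phi_hom: "X \<in> Obj A \<Longrightarrow> \<phi> X \<in> hom A (L \<cdot> R \<cdot> X) (G \<cdot> X)"
  using phi.component by simp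

lemma phi_naturality:
  "f \<in> hom A X Y \<Longrightarrow> (G \<star> f) \<odot>\<^bsub>A\<^esub> \<phi> X = \<phi> Y \<odot>\<^bsub>A\<^esub> (L \<star> R \<star> f)"
  using phi.naturality by simp

lemma coact_hom:
  assumes Y: "Y \<in> Obj B" shows "coact Y \<in> hom A (L \<cdot> Y) (G \<cdot> L \<cdot> Y)"
  unfolding coact_def using L.B.comp_hom[OF L.map_hom[OF unit_hom[OF Y]] phi_hom[OF L.map_obj[OF Y]]] .

lemma mate_hom:
  assumes X: "X \<in> Obj A" shows "\<alpha> X \<in> hom B (R \<cdot> X) (R \<cdot> G \<cdot> X)"
  unfolding mate_def
  using L.A.comp_hom[OF unit_hom[OF R.map_obj[OF X]] R.map_hom[OF phi_hom[OF X]]] .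

text \<open>Naturality of \<open>\<phi>\<close> moves an arrow out of \<open>LY\<close> past the coaction and turns it into its transpose.
  Coassociativity of the coaction, the action of \<open>K\<^sub>\<phi>\<close> on arrows and the description of coalgebra
  morphisms out of \<open>K\<^sub>\<phi>Y\<close> all start from this.\<close>

lemma map_coact:
  assumes Y: "Y \<in> Obj B" and f: "f \<in> hom A (L \<cdot> Y) X"
  shows "(G \<star> f) \<odot>\<^bsub>A\<^esub> coact Y = \<phi> X \<odot>\<^bsub>A\<^esub> (L \<star> flat Y f)"
proof -
  have X: "X \<in> Obj A" using L.B.hom_obj(2)[OF f] .
  note L\<eta> = L.map_hom[OF unit_hom[OF Y]] and Rf = R.map_hom[OF f]
  have "(G \<star> f) \<odot>\<^bsub>A\<^esub> coact Y = ((G \<star> f) \<odot>\<^bsub>A\<^esub> \<phi> (L \<cdot> Y)) \<odot>\<^bsub>A\<^esub> (L \<star> \<eta> Y)"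
    by (simp add: coact_def
      L.B.comp_assoc[OF L\<eta> phi_hom[OF L.map_obj[OF Y]] phi.target.comult.F.map_hom[OF f]])
  also have "\<dots> = \<phi> X \<odot>\<^bsub>A\<^esub> (L \<star> flat Y f)"
    by (simp add: phi_naturality[OF f] flat_def L.map_comp[OF unit_hom[OF Y] Rf]
      L.B.comp_assoc[OF L\<eta> L.map_hom[OF Rf] phi_hom[OF X]])
  finally show ?thesis .
qed

lemma flat_phi:
  assumes X: "X \<in> Obj A" and h: "h \<in> hom B Y (R \<cdot> X)"
  shows "flat Y (\<phi> X \<odot>\<^bsub>A\<^esub> (L \<star> h)) = \<alpha> X \<odot>\<^bsub>B\<^esub> h"
proof -
  have Y: "Y \<in> Obj B" using L.A.hom_obj(1)[OF h] .
  have "flat Y (\<phi> X \<odot>\<^bsub>A\<^esub> (L \<star> h)) = (R \<star> \<phi> X) \<odot>\<^bsub>B\<^esub> (\<eta> (R \<cdot> X) \<odot>\<^bsub>B\<^esub> h)"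
    by (simp add: flat_comp[OF Y L.map_hom[OF h] phi_hom[OF X]])
      (simp add: flat_def unit_naturality[OF h])
  then show ?thesis
    by (simp add: mate_def
      L.A.comp_assoc[OF h unit_hom[OF R.map_obj[OF X]] R.map_hom[OF phi_hom[OF X]]])
qed

lemma comult_phi:
  assumes X: "X \<in> Obj A"
  shows "\<Delta> X \<odot>\<^bsub>A\<^esub> \<phi> X = \<phi> (G \<cdot> X) \<odot>\<^bsub>A\<^esub> (L \<star> \<alpha> X)"
proof -
  note \<eta>R = unit_hom[OF R.map_obj[OF X]] and R\<phi> = R.map_hom[OF phi_hom[OF X]]
  show ?thesis
    using phi.comult_compat[OF X]
      L.B.comp_assoc[OF L.map_hom[OF \<eta>R] L.map_hom[OF R\<phi>]
        phi_hom[OF phi.target.comult.F.map_obj[OF X]]]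
    by (simp add: adj_comult_def mate_def L.map_comp[OF \<eta>R R\<phi>])
qed

text \<open>By \<open>flat_phi\<close> the transpose of the coaction \<open>\<phi>\<^sub>L\<^sub>Y \<circ> L\<eta>\<^sub>Y\<close> is \<open>\<alpha>\<^sub>L\<^sub>Y \<circ> \<eta>\<^sub>Y\<close>, so both sides of
  coassociativity become \<open>\<phi>\<^sub>G\<^sub>L\<^sub>Y \<circ> L(\<alpha>\<^sub>L\<^sub>Y \<circ> \<eta>\<^sub>Y)\<close>.\<close>

lemma comparison_coalgebra:
  assumes Y: "Y \<in> Obj B" shows "is_coalgebra A G \<Delta> \<epsilon> (L \<cdot> Y) (coact Y)"
proof -
  note LY = L.map_obj[OF Y] and \<eta>Y = unit_hom[OF Y]
  note GLY = phi.target.comult.F.map_obj[OF LY]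
  note L\<eta> = L.map_hom[OF \<eta>Y]
  have \<Delta>: "\<Delta> (L \<cdot> Y) \<in> hom A (G \<cdot> L \<cdot> Y) (G \<cdot> G \<cdot> L \<cdot> Y)"
    using phi.target.comult.component[OF LY] by simp
  have \<epsilon>: "\<epsilon> (L \<cdot> Y) \<in> hom A (G \<cdot> L \<cdot> Y) (L \<cdot> Y)"
    using phi.target.counit.component[OF LY] by simp
  have "(G \<star> coact Y) \<odot>\<^bsub>A\<^esub> coact Y = \<phi> (G \<cdot> L \<cdot> Y) \<odot>\<^bsub>A\<^esub> (L \<star> (\<alpha> (L \<cdot> Y) \<odot>\<^bsub>B\<^esub> \<eta> Y))"
    using map_coact[OF Y coact_hom[OF Y]] flat_phi[OF LY \<eta>Y] by (simp add: coact_def)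
  also have "\<dots> = (\<Delta> (L \<cdot> Y) \<odot>\<^bsub>A\<^esub> \<phi> (L \<cdot> Y)) \<odot>\<^bsub>A\<^esub> (L \<star> \<eta> Y)"
    by (simp add: comult_phi[OF LY] L.map_comp[OF \<eta>Y mate_hom[OF LY]]
      L.B.comp_assoc[OF L\<eta> L.map_hom[OF mate_hom[OF LY]] phi_hom[OF GLY]])
  also have "\<dots> = \<Delta> (L \<cdot> Y) \<odot>\<^bsub>A\<^esub> coact Y"
    by (simp add: coact_def L.B.comp_assoc[OF L\<eta> phi_hom[OF LY] \<Delta>])
  finally have coassoc: "(G \<star> coact Y) \<odot>\<^bsub>A\<^esub> coact Y = \<Delta> (L \<cdot> Y) \<odot>\<^bsub>A\<^esub> coact Y" .
  have "\<epsilon> (L \<cdot> Y) \<odot>\<^bsub>A\<^esub> coact Y = Ide A (L \<cdot> Y)"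
    by (simp add: coact_def L.B.comp_assoc[OF L\<eta> phi_hom[OF LY] \<epsilon>, symmetric]
      phi.counit_compat[OF LY] triangle_L[OF Y])
  with coassoc coact_hom[OF Y] LY show ?thesis by (simp add: is_coalgebra_def)
qed

lemma K_obj: "K \<cdot> Y = (L \<cdot> Y, coact Y)"
  by (simp add: comparison_def comparison_obj_def coact_def)

lemma K_arr: "f \<in> hom B Y Z \<Longrightarrow> K \<star> f = ((L \<cdot> Y, coact Y), L \<star> f, (L \<cdot> Z, coact Z))"
  by (auto simp: comparison_def comparison_obj_def coact_def hom_def)

lemma comparison_functor: "is_functor B coalg K"
proof -
  interpret C: category coalg by (rule phi.target.coalg_category)
  show ?thesis
  proof unfold_locales
    fix Y assume Y: "Y \<in> Obj B"
    show "K \<cdot> Y \<in> Obj coalg"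
      by (simp add: K_obj Obj_coalg_cat_iff comparison_coalgebra[OF Y])
    show "K \<star> Ide B Y = Ide coalg (K \<cdot> Y)"
      by (simp add: K_obj K_arr[OF L.A.id_hom[OF Y]] L.map_id[OF Y] Ide_coalg_cat)
  next
    fix f Y Z assume f: "f \<in> hom B Y Z"
    have Y: "Y \<in> Obj B" and Z: "Z \<in> Obj B" using L.A.hom_obj[OF f] .
    note \<eta>Z = unit_hom[OF Z] and LZ = L.map_obj[OF Z]
    have "(G \<star> L \<star> f) \<odot>\<^bsub>A\<^esub> coact Y = \<phi> (L \<cdot> Z) \<odot>\<^bsub>A\<^esub> (L \<star> (\<eta> Z \<odot>\<^bsub>B\<^esub> f))"
      by (simp add: map_coact[OF Y L.map_hom[OF f]]) (simp add: flat_def unit_naturality[OF f])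
    also have "\<dots> = coact Z \<odot>\<^bsub>A\<^esub> (L \<star> f)"
      by (simp add: coact_def L.map_comp[OF f \<eta>Z]
        L.B.comp_assoc[OF L.map_hom[OF f] L.map_hom[OF \<eta>Z] phi_hom[OF LZ]])
    finally show "K \<star> f \<in> hom coalg (K \<cdot> Y) (K \<cdot> Z)"
      by (simp add: K_obj K_arr[OF f] hom_coalg_cat_iff comparison_coalgebra Y Z L.map_hom[OF f])
  next
    fix f Y Z g W assume f: "f \<in> hom B Y Z" and g: "g \<in> hom B Z W"
    then show "K \<star> (g \<odot>\<^bsub>B\<^esub> f) = (K \<star> g) \<odot>\<^bsub>coalg\<^esub> (K \<star> f)"
      by (simp add: K_arr[OF f] K_arr[OF g] K_arr[OF L.A.comp_hom[OF f g]] Comp_coalg_cat L.map_comp)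
  qed
qed

text \<open>Each side of the morphism condition is transposed separately; transposition is injective, so the
  condition and its transpose are equivalent.\<close>

lemma coalgebra_morphism_iff_equalizes:
  assumes X: "X \<in> Obj A" and x: "x \<in> hom A X (G \<cdot> X)" and h: "h \<in> hom B Y (R \<cdot> X)"
  shows "(G \<star> sharp X h) \<odot>\<^bsub>A\<^esub> coact Y = x \<odot>\<^bsub>A\<^esub> sharp X h \<longleftrightarrow>
    \<alpha> X \<odot>\<^bsub>B\<^esub> h = (R \<star> x) \<odot>\<^bsub>B\<^esub> h"
proof -
  have Y: "Y \<in> Obj B" using L.A.hom_obj(1)[OF h] .
  note f = sharp_hom[OF X h]
  have "(G \<star> sharp X h) \<odot>\<^bsub>A\<^esub> coact Y = \<phi> X \<odot>\<^bsub>A\<^esub> (L \<star> h)"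
    by (simp add: map_coact[OF Y f] flat_sharp[OF X h])
  then show ?thesis
    using flat_eq_iff[OF Y L.B.comp_hom[OF L.map_hom[OF h] phi_hom[OF X]] L.B.comp_hom[OF f x]]
    by (simp add: flat_phi[OF X h] flat_sharp_comp[OF X h x])
qed

end


section \<open>The right adjoint of the comparison functor\<close>

lemma is_equalizerD:
  assumes eq: "is_equalizer C f g E e" and f: "f \<in> hom C X Y"
  shows "e \<in> hom C E X" "f \<odot>\<^bsub>C\<^esub> e = g \<odot>\<^bsub>C\<^esub> e"
    "h \<in> hom C Z X \<Longrightarrow> f \<odot>\<^bsub>C\<^esub> h = g \<odot>\<^bsub>C\<^esub> h \<Longrightarrow> \<exists>!k. k \<in> hom C Z E \<and> e \<odot>\<^bsub>C\<^esub> k = h"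
proof -
  obtain X' Y' where f': "f \<in> hom C X' Y'" and e: "e \<in> hom C E X'"
    and fe: "f \<odot>\<^bsub>C\<^esub> e = g \<odot>\<^bsub>C\<^esub> e"
    and univ: "\<And>Z h. h \<in> hom C Z X' \<and> f \<odot>\<^bsub>C\<^esub> h = g \<odot>\<^bsub>C\<^esub> h \<longrightarrow>
      (\<exists>!k. k \<in> hom C Z E \<and> e \<odot>\<^bsub>C\<^esub> k = h)"
    using eq unfolding is_equalizer_def by blast
  have X': "X' = X" using f f' by (simp add: hom_def)
  show "e \<in> hom C E X" using e X' by simp
  show "f \<odot>\<^bsub>C\<^esub> e = g \<odot>\<^bsub>C\<^esub> e" by (rule fe)
  show "\<exists>!k. k \<in> hom C Z E \<and> e \<odot>\<^bsub>C\<^esub> k = h"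
    if "h \<in> hom C Z X" "f \<odot>\<^bsub>C\<^esub> h = g \<odot>\<^bsub>C\<^esub> h"
    using univ[of h Z] that unfolding X' by blast
qed

locale comparison_equalizers = adjunction_comonad_morphism B A L R \<eta> \<epsilon>\<^sub>L\<^sub>R G \<Delta> \<epsilon> \<phi>
  for B :: "('p, 'n) cat" and A :: "('o, 'm) cat"
    and L :: "('p, 'n, 'o, 'm) func" and R :: "('o, 'm, 'p, 'n) func"
    and \<eta> :: "'p \<Rightarrow> 'n" and \<epsilon>\<^sub>L\<^sub>R :: "'o \<Rightarrow> 'm"
    and G :: "('o, 'm, 'o, 'm) func" and \<Delta> \<epsilon> \<phi> :: "'o \<Rightarrow> 'm" +
  fixes E :: "'o \<times> 'm \<Rightarrow> 'p" and e :: "'o \<times> 'm \<Rightarrow> 'n"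
  assumes equalizer: "is_coalgebra A G \<Delta> \<epsilon> X x \<Longrightarrow>
    is_equalizer B (\<alpha> X) (R \<star> x) (E (X, x)) (e (X, x))"
begin

definition arrow
  where "arrow = (\<lambda>(X, x). (K \<cdot> E (X, x), sharp X (e (X, x)), (X, x)))"

lemma e_props:
  assumes c: "is_coalgebra A G \<Delta> \<epsilon> X x"
  shows "e (X, x) \<in> hom B (E (X, x)) (R \<cdot> X)"
    "\<alpha> X \<odot>\<^bsub>B\<^esub> e (X, x) = (R \<star> x) \<odot>\<^bsub>B\<^esub> e (X, x)"
    "h \<in> hom B Y (R \<cdot> X) \<Longrightarrow> \<alpha> X \<odot>\<^bsub>B\<^esub> h = (R \<star> x) \<odot>\<^bsub>B\<^esub> h \<Longrightarrow>
      \<exists>!k. k \<in> hom B Y (E (X, x)) \<and> e (X, x) \<odot>\<^bsub>B\<^esub> k = h"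
  by (fact is_equalizerD[OF equalizer[OF c] mate_hom[OF is_coalgebraD(1)[OF c]]])+

lemma arrow_comp:
  assumes c: "is_coalgebra A G \<Delta> \<epsilon> X x" and k: "k \<in> hom B Y (E (X, x))"
  shows "arrow (X, x) \<odot>\<^bsub>coalg\<^esub> (K \<star> k) = (K \<cdot> Y, sharp X (e (X, x) \<odot>\<^bsub>B\<^esub> k), (X, x))"
  by (simp add: arrow_def K_arr[OF k] K_obj Comp_coalg_cat
    sharp_comp[OF is_coalgebraD(1)[OF c] k e_props(1)[OF c]])

text \<open>Because transposition is injective, a factorization \<open>k\<close> of a morphism \<open>K\<^sub>\<phi>Y \<rightarrow> (X, x)\<close> through
  \<open>arrow (X, x)\<close> is the same as a factorization of its transpose through \<open>e (X, x)\<close>; the universal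
  property is thereby that of the equalizer.\<close>

lemma arrow_universal: "universal_arrows B coalg K E arrow"
proof -
  interpret K: is_functor B coalg K by (rule comparison_functor)
  show ?thesis
  proof unfold_locales
    fix S assume S: "S \<in> Obj coalg"
    then obtain X x where [simp]: "S = (X, x)" and c: "is_coalgebra A G \<Delta> \<epsilon> X x"
      by (cases S) (auto simp: Obj_coalg_cat_iff)
    note X = is_coalgebraD(1)[OF c] and x = is_coalgebraD(2)[OF c] and e = e_props[OF c]
    show E: "E S \<in> Obj B" using L.A.hom_obj(1)[OF e(1)] by simp
    show "arrow S \<in> hom coalg (K \<cdot> E S) S"
      using E c e(2) coalgebra_morphism_iff_equalizes[OF X x e(1)] sharp_hom[OF X e(1)]
      by (simp add: arrow_def K_obj hom_coalg_cat_iff comparison_coalgebra)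
    fix Y g assume Y: "Y \<in> Obj B" and g: "g \<in> hom coalg (K \<cdot> Y) S"
    then obtain f where g_eq: "g = (K \<cdot> Y, f, (X, x))" and f: "f \<in> hom A (L \<cdot> Y) X"
      and mor: "(G \<star> f) \<odot>\<^bsub>A\<^esub> coact Y = x \<odot>\<^bsub>A\<^esub> f"
      by (auto simp: hom_coalg_cat_iff K_obj)
    have h: "flat Y f \<in> hom B Y (R \<cdot> X)" using flat_hom[OF Y f] .
    have "k \<in> hom B Y (E S) \<and> arrow S \<odot>\<^bsub>coalg\<^esub> (K \<star> k) = g \<longleftrightarrow>
        k \<in> hom B Y (E (X, x)) \<and> e (X, x) \<odot>\<^bsub>B\<^esub> k = flat Y f" for k
      using sharp_eq_iff[OF X L.A.comp_hom[OF _ e(1)] h, of k]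
      by (auto simp: arrow_comp[OF c] g_eq sharp_flat[OF Y f])
    moreover have "\<alpha> X \<odot>\<^bsub>B\<^esub> flat Y f = (R \<star> x) \<odot>\<^bsub>B\<^esub> flat Y f"
      using coalgebra_morphism_iff_equalizes[OF X x h] mor by (simp add: sharp_flat[OF Y f])
    ultimately show "\<exists>!k. k \<in> hom B Y (E S) \<and> arrow S \<odot>\<^bsub>coalg\<^esub> (K \<star> k) = g"
      using e(3)[OF h] by simp
  qed
qed

sublocale U: universal_arrows B coalg K E arrow
  by (rule arrow_universal)

text \<open>For \<open>f\<close> underlying \<open>g: (X, x) \<rightarrow> (X', x')\<close>, the arrow \<open>D\<^sub>\<phi>g\<close> is determined by the equation
  \<open>\<epsilon>\<^sub>X\<^sub>' \<circ> L(e\<^sub>X\<^sub>' \<circ> D\<^sub>\<phi>g) = f \<circ> \<epsilon>\<^sub>X \<circ> Le\<^sub>X\<close>, in which \<open>\<epsilon>\<close> is the counit of \<open>L \<stileturn> R\<close>. Its transpose is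
  the naturality square of \<open>e\<close> at \<open>g\<close>.\<close>

lemma equalizer_natural: "nat_trans coalg B U.D (R \<bullet> forgetful) e"
proof -
  interpret D: is_functor coalg B U.D by (rule U.D_functor)
  interpret RU: is_functor coalg B "R \<bullet> forgetful"
    by (rule is_functor_comp[OF phi.target.forgetful_functor]) unfold_locales
  show ?thesis
  proof unfold_locales
    fix S assume S: "S \<in> Obj coalg"
    then show "e S \<in> hom B (U.D \<cdot> S) ((R \<bullet> forgetful) \<cdot> S)"
      by (cases S) (simp add: forgetful_def Obj_coalg_cat_iff e_props)
  next
    fix g S T assume g: "g \<in> hom coalg S T"
    obtain X x X' x' where [simp]: "S = (X, x)" "T = (X', x')" by (cases S, cases T)
    from g obtain f where [simp]: "g = ((X, x), f, (X', x'))"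
      and c: "is_coalgebra A G \<Delta> \<epsilon> X x" and c': "is_coalgebra A G \<Delta> \<epsilon> X' x'"
      and f: "f \<in> hom A X X'"
      by (auto simp: hom_coalg_cat_iff)
    note X = is_coalgebraD(1)[OF c] and X' = is_coalgebraD(1)[OF c']
    note e = e_props(1)[OF c] and e' = e_props(1)[OF c'] and Dg = U.D_arr[OF g]
    have Dg': "U.D \<star> g \<in> hom B (E (X, x)) (E (X', x'))" using Dg(1) by simp
    have "sharp X' (e (X', x') \<odot>\<^bsub>B\<^esub> (U.D \<star> g)) = f \<odot>\<^bsub>A\<^esub> sharp X (e (X, x))"
      using Dg(2) arrow_comp[OF c' Dg'] by (simp add: arrow_def Comp_coalg_cat)
    then have "flat (E (X, x)) (sharp X' (e (X', x') \<odot>\<^bsub>B\<^esub> (U.D \<star> g))) = (R \<star> f) \<odot>\<^bsub>B\<^esub> e (X, x)"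
      by (simp add: flat_sharp_comp[OF X e f])
    then show "((R \<bullet> forgetful) \<star> g) \<odot>\<^bsub>B\<^esub> e S = e T \<odot>\<^bsub>B\<^esub> (U.D \<star> g)"
      using flat_sharp[OF X' L.A.comp_hom[OF Dg' e']] by (simp add: forgetful_def)
  qed
qed

end

theorem mainTheorem3:
  fixes A :: "('o, 'm) cat" and B :: "('p, 'n) cat"
    and G :: "('o, 'm, 'o, 'm) func" and \<Delta> \<epsilon> :: "'o \<Rightarrow> 'm"
    and L :: "('p, 'n, 'o, 'm) func" and R :: "('o, 'm, 'p, 'n) func"
    and \<eta> :: "'p \<Rightarrow> 'n" and \<epsilon>\<^sub>L\<^sub>R :: "'o \<Rightarrow> 'm" and \<phi> :: "'o \<Rightarrow> 'm"
  assumes "comonad A G \<Delta> \<epsilon>"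
    and "adjunction B A L R \<eta> \<epsilon>\<^sub>L\<^sub>R"
    and "comonad_morphism A (L \<bullet> R) (adj_comult L R \<eta>) \<epsilon>\<^sub>L\<^sub>R G \<Delta> \<epsilon> \<phi>"
    and "\<And>X x. is_coalgebra A G \<Delta> \<epsilon> X x \<Longrightarrow>
      \<exists>E e. is_equalizer B (mate B R \<eta> \<phi> X) (R \<star> x) E e"
  shows "\<exists>D eq.
    right_adjoint B (coalg_cat A G \<Delta> \<epsilon>) (comparison B A L \<eta> \<phi>) D \<and>
    nat_trans (coalg_cat A G \<Delta> \<epsilon>) B D (R \<bullet> forgetful) eq \<and>
    (\<forall>X x. is_coalgebra A G \<Delta> \<epsilon> X x \<longrightarrow>
      is_equalizer B (mate B R \<eta> \<phi> X) (R \<star> x) (D \<cdot> (X, x)) (eq (X, x)))"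
proof -
  interpret adjunction_comonad_morphism B A L R \<eta> \<epsilon>\<^sub>L\<^sub>R G \<Delta> \<epsilon> \<phi>
    using assms(2,3) by (rule adjunction_comonad_morphism.intro)
  have "\<forall>S. \<exists>E e. is_coalgebra A G \<Delta> \<epsilon> (fst S) (snd S) \<longrightarrow>
      is_equalizer B (\<alpha> (fst S)) (R \<star> snd S) E e"
    using assms(4) by blast
  then obtain E e where E: "\<And>S. is_coalgebra A G \<Delta> \<epsilon> (fst S) (snd S) \<Longrightarrow>
      is_equalizer B (\<alpha> (fst S)) (R \<star> snd S) (E S) (e S)"
    by metis
  interpret comparison_equalizers B A L R \<eta> \<epsilon>\<^sub>L\<^sub>R G \<Delta> \<epsilon> \<phi> E e
    by unfold_locales (use E in fastforce)
  show ?thesis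
    using U.adjunction equalizer_natural equalizer unfolding right_adjoint_def
    by (intro exI[of _ U.D] exI[of _ e]) auto
qed

end
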